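(* Let $X_1,X_2,\dots$ be i.i.d. real random variables with distribution function $F$, and let $\beta_{0,n}^{s,t}$ be the $0$-th persistent Betti numbers of the sublevel set filtration of $X_1,\dots,X_n$. Then for any $-\infty<s\le t\le\infty$ with $F(s)\in(0,1)$, \[ \frac{\mathbb{E}[\beta_{0,n}^{s,t}]}{n}\to\frac{(1-F(t))F(s)}{1-F(t)+F(s)},\qquad n\to\infty, \] and the limit is $0$ otherwise (i.e. if $F(s)\in\{0,1\}$).
   Context: Convention: $F(\infty)=1$. Let $K$ be the graph (simplicial complex) with vertices $v_0,v_1,v_2,\dots$ and edges $\{v_i,v_{i+1}\}$, $i\ge 0$. For $n\ge1$ put $X_{k,n}=X_k$ for $1\le k\le n$, and $X_{k,n}=\infty$ for $k=0$ and for $k>n$. For $t\in(-\infty,\infty]$ let $K_n(t)=\{\sigma\in K:\max_{v_i\in\sigma}X_{i,n}\le t\}$ (so $K_n(\infty)=K$). With $\mathbb{Z}_2$ coefficients, for $-\infty<s\le t\le\infty$ the persistent Betti number $\beta_{0,n}^{s,t}$ is the dimension of the image of the map $H_0(K_n(s))\to H_0(K_n(t))$ induced by inclusion. *)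

theory Defs
  imports
    "HOL-Probability.Probability"
    "HOL-Algebra.AbelCoset"
    "HOL-Library.Poly_Mapping"
    "HOL-Library.Z2"
    "Jordan_Normal_Form.VS_Connect"
begin

section \<open>Simplicial homology with coefficients in the two-element field\<close>

text \<open>
  A simplicial complex is given by its set of (finite, nonempty) simplices \<open>K :: 'v set set\<close>;
  a \<open>p\<close>-simplex has \<open>p + 1\<close> vertices.  Vector spaces are \<^const>\<open>vectorspace\<close>s over
  \<open>class_ring :: bit ring\<close>, where \<^typ>\<open>bit\<close> is the field with two elements.  The record
  fields \<open>mult\<close> and \<open>one\<close> play no role for modules.
\<close>

definition chain_space :: "nat \<Rightarrow> 'v set set \<Rightarrow> (bit, 'v set \<Rightarrow>\<^sub>0 bit) module" where
  "chain_space p K =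
    \<lparr> carrier = {c. Poly_Mapping.keys c \<subseteq> {\<sigma> \<in> K. finite \<sigma> \<and> card \<sigma> = Suc p}},
      mult = undefined,
      one = undefined,
      zero = 0,
      add = (+),
      smult = (\<lambda>a. Poly_Mapping.map ((*) a)) \<rparr>"

text \<open>Homology is not reduced: the boundary of a \<open>0\<close>-chain is zero.\<close>

definition boundary :: "nat \<Rightarrow> ('v set \<Rightarrow>\<^sub>0 bit) \<Rightarrow> ('v set \<Rightarrow>\<^sub>0 bit)" where
  "boundary p c =
    (if p = 0 then 0
     else \<Sum>\<sigma>\<in>Poly_Mapping.keys c. \<Sum>v\<in>\<sigma>.
            Poly_Mapping.single (\<sigma> - {v}) (Poly_Mapping.lookup c \<sigma>))"

definition cycle_space :: "nat \<Rightarrow> 'v set set \<Rightarrow> (bit, 'v set \<Rightarrow>\<^sub>0 bit) module" where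
  "cycle_space p K =
    (chain_space p K)\<lparr> carrier := {c \<in> carrier (chain_space p K). boundary p c = 0} \<rparr>"

definition boundaries :: "nat \<Rightarrow> 'v set set \<Rightarrow> ('v set \<Rightarrow>\<^sub>0 bit) set" where
  "boundaries p K = boundary (Suc p) ` carrier (chain_space (Suc p) K)"

definition quotient_space :: "('k, 'a) module \<Rightarrow> 'a set \<Rightarrow> ('k, 'a set) module" where
  "quotient_space V W =
    \<lparr> carrier = a_rcosets\<^bsub>V\<^esub> W,
      mult = undefined,
      one = undefined,
      zero = W,
      add = set_add V,
      smult = (\<lambda>a A. \<Union>x\<in>A. W +>\<^bsub>V\<^esub> (a \<odot>\<^bsub>V\<^esub> x)) \<rparr>"

definition homology :: "nat \<Rightarrow> 'v set set \<Rightarrow> (bit, ('v set \<Rightarrow>\<^sub>0 bit) set) module" where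
  "homology p K = quotient_space (cycle_space p K) (boundaries p K)"

text \<open>
  The map \<open>H\<^sub>p(K) \<rightarrow> H\<^sub>p(L)\<close> induced by an inclusion \<open>K \<subseteq> L\<close> sends the class in \<open>H\<^sub>p(K)\<close> of a
  cycle \<open>z\<close> to its class in \<open>H\<^sub>p(L)\<close>.  All cycles \<open>z\<close> in the coset \<open>A\<close> have the same class
  in \<open>H\<^sub>p(L)\<close>, so the image below is a singleton.
\<close>

definition homology_incl ::
  "nat \<Rightarrow> 'v set set \<Rightarrow> ('v set \<Rightarrow>\<^sub>0 bit) set \<Rightarrow> ('v set \<Rightarrow>\<^sub>0 bit) set" where
  "homology_incl p L A = the_elem ((\<lambda>z. boundaries p L +>\<^bsub>cycle_space p L\<^esub> z) ` A)"

definition persistent_betti :: "nat \<Rightarrow> 'v set set \<Rightarrow> 'v set set \<Rightarrow> nat" where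
  "persistent_betti p K L =
    vectorspace.dim class_ring
      ((homology p L)\<lparr> carrier := homology_incl p L ` carrier (homology p K) \<rparr>)"


section \<open>The sublevel set filtration of a finite sequence\<close>

definition path_complex :: "nat set set" where
  "path_complex = (\<Union>i. {{i}, {i, Suc i}})"

definition truncated :: "(nat \<Rightarrow> real) \<Rightarrow> nat \<Rightarrow> nat \<Rightarrow> ereal" where
  "truncated x n k = (if 1 \<le> k \<and> k \<le> n then ereal (x k) else \<infinity>)"

definition sublevel_complex :: "(nat \<Rightarrow> real) \<Rightarrow> nat \<Rightarrow> ereal \<Rightarrow> nat set set" where
  "sublevel_complex x n t = {\<sigma> \<in> path_complex. Max (truncated x n ` \<sigma>) \<le> t}"

definition sublevel_betti :: "nat \<Rightarrow> (nat \<Rightarrow> real) \<Rightarrow> nat \<Rightarrow> ereal \<Rightarrow> ereal \<Rightarrow> nat" where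
  "sublevel_betti p x n s t = persistent_betti p (sublevel_complex x n s) (sublevel_complex x n t)"

text \<open>A distribution function on the reals, extended by the value \<open>1\<close> at \<open>\<infinity>\<close>; the value at
  \<open>-\<infinity>\<close> is irrelevant.\<close>

definition extend_cdf :: "(real \<Rightarrow> real) \<Rightarrow> ereal \<Rightarrow> real" where
  "extend_cdf F t = (if t = \<infinity> then 1 else F (real_of_ereal t))"

end

theory Submission
  imports Defs
begin

text \<open>
  In degree zero a persistent Betti number counts the components of the larger complex that meet
  the smaller one (\<open>persistent_betti_0_eq_card\<close>).  For a path, a component at level \<open>t\<close> is a run of
  consecutive vertices with values at most \<open>t\<close>, and it can be counted at its first vertex with value
  at most \<open>s\<close>.  For \<open>s < \<infinity>\<close> this turns the Betti number into a sum of indicators over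
  \<open>k = 0, \<dots>, n - 1\<close> (\<open>sublevel_betti_eq_sum\<close>): position \<open>k + 1\<close> is counted if its value is at most
  \<open>s\<close> and if, looking back from it, a value above \<open>t\<close> or the beginning of the sequence comes before
  any value at most \<open>s\<close>.

  The second condition involves only \<open>X 1, \<dots>, X k\<close>.  By independence its probability \<open>g k\<close>
  satisfies \<open>g 0 = 1\<close> and \<open>g (k + 1) = (1 - F(t)) + (F(t) - F(s)) g k\<close> (\<open>prob_clear_Suc\<close>), and the
  expected Betti number is \<open>F(s) (g 0 + \<dots> + g (n - 1))\<close>.  If \<open>F(s) > 0\<close>, the recursion is a
  contraction, \<open>g k\<close> converges geometrically to its fixed point
  \<open>L = (1 - F(t)) / (1 - F(t) + F(s))\<close>, and the averages converge to \<open>F(s) L\<close>.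

  The degenerate values need little more.  If \<open>F(s) = 0\<close>, all summands vanish.  If \<open>F(s) = 1\<close> with
  \<open>s\<close> finite, then \<open>F(t) = 1\<close> and \<open>L = 0\<close>.  If \<open>s = \<infinity>\<close>, both complexes are the whole path and the
  Betti number is constantly one.
\<close>


section \<open>Quotients of modules and a criterion for the dimension\<close>

text \<open>
  A submodule is only required to be closed under addition and scalars; it absorbs inverses
  because \<open>- w = (- 1) w\<close>.  This opens up the library of additive cosets.
\<close>

lemma additive_subgroup_of_submodule:
  assumes "LinearCombinations.submodule R W V"
  shows "additive_subgroup W V"
proof -
  interpret V: module R V using assms by (rule LinearCombinations.submodule.module)
  interpret W: LinearCombinations.submodule R W V by fact
  show ?thesis
  proof (intro additive_subgroup.intro V.add.subgroupI)
    show "W \<subseteq> carrier V" by (rule W.subset)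
    show "W \<noteq> {}" using W.zero_closed by blast
  next
    fix w assume w: "w \<in> W"
    have "\<ominus>\<^bsub>R\<^esub> \<one>\<^bsub>R\<^esub> \<odot>\<^bsub>V\<^esub> w \<in> W" using w by (intro W.smult_closed) auto
    moreover have "w \<in> carrier V" using w W.subset by blast
    ultimately show "\<ominus>\<^bsub>V\<^esub> w \<in> W" by (metis V.smult_minus_1)
  next
    fix v w assume "v \<in> W" "w \<in> W"
    then show "v \<oplus>\<^bsub>V\<^esub> w \<in> W" by (rule W.m_closed)
  qed
qed

context
  fixes R :: "('k, 'r) ring_scheme" and V :: "('k, 'v) module" and W
  assumes sub: "LinearCombinations.submodule R W V"
begin

interpretation V: module R V using sub by (rule LinearCombinations.submodule.module)
interpretation W: LinearCombinations.submodule R W V by (rule sub)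
interpretation W: abelian_subgroup W V
  by (rule abelian_subgroupI3[OF additive_subgroup_of_submodule[OF sub] V.abelian_group_axioms])

lemma carrier_quotient_space:
  "carrier (quotient_space V W) = (\<lambda>x. W +>\<^bsub>V\<^esub> x) ` carrier V"
  by (auto simp: quotient_space_def A_RCOSETS_def')

lemma zero_quotient_space:
  "\<zero>\<^bsub>quotient_space V W\<^esub> = W +>\<^bsub>V\<^esub> \<zero>\<^bsub>V\<^esub>"
  by (simp add: quotient_space_def V.a_coset_add_zero W.subset)

lemma coset_eq_iff:
  assumes "x \<in> carrier V" "y \<in> carrier V"
  shows "W +>\<^bsub>V\<^esub> x = W +>\<^bsub>V\<^esub> y \<longleftrightarrow> x \<ominus>\<^bsub>V\<^esub> y \<in> W"
proof
  assume "W +>\<^bsub>V\<^esub> x = W +>\<^bsub>V\<^esub> y"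
  then have "x \<in> W +>\<^bsub>V\<^esub> y" using W.a_rcos_self[OF assms(1)] by simp
  then show "x \<ominus>\<^bsub>V\<^esub> y \<in> W" using assms W.a_rcos_module_imp unfolding a_minus_def by blast
next
  assume "x \<ominus>\<^bsub>V\<^esub> y \<in> W"
  then have "x \<in> W +>\<^bsub>V\<^esub> y" using assms W.a_rcos_module_rev unfolding a_minus_def by blast
  then show "W +>\<^bsub>V\<^esub> x = W +>\<^bsub>V\<^esub> y"
    using V.a_repr_independence[OF _ assms(2) W.a_subgroup] by simp
qed

lemma add_quotient_space:
  assumes "x \<in> carrier V" "y \<in> carrier V"
  shows "(W +>\<^bsub>V\<^esub> x) \<oplus>\<^bsub>quotient_space V W\<^esub> (W +>\<^bsub>V\<^esub> y) = W +>\<^bsub>V\<^esub> (x \<oplus>\<^bsub>V\<^esub> y)"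
  using assms by (simp add: quotient_space_def W.a_rcos_sum)

text \<open>
  The scalar multiple of a coset is formed as a union over all its elements; the union collapses
  since two elements of the coset differ by some \<open>w \<in> W\<close> and \<open>a w \<in> W\<close>.
\<close>

lemma smult_quotient_space:
  assumes "a \<in> carrier R" "x \<in> carrier V"
  shows "a \<odot>\<^bsub>quotient_space V W\<^esub> (W +>\<^bsub>V\<^esub> x) = W +>\<^bsub>V\<^esub> (a \<odot>\<^bsub>V\<^esub> x)"
proof -
  have const: "W +>\<^bsub>V\<^esub> (a \<odot>\<^bsub>V\<^esub> y) = W +>\<^bsub>V\<^esub> (a \<odot>\<^bsub>V\<^esub> x)" if y: "y \<in> W +>\<^bsub>V\<^esub> x" for y
  proof -
    obtain w where w: "w \<in> W" "y = w \<oplus>\<^bsub>V\<^esub> x"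
      using y unfolding a_r_coset_def' by (elim UN_E singletonE)
    have wV: "w \<in> carrier V" using w W.subset by blast
    then have yV: "y \<in> carrier V" using w assms by simp
    have "a \<odot>\<^bsub>V\<^esub> y \<ominus>\<^bsub>V\<^esub> a \<odot>\<^bsub>V\<^esub> x = a \<odot>\<^bsub>V\<^esub> w"
      using assms w wV by (simp add: V.smult_r_distr a_minus_def V.a_assoc V.r_neg)
    then show ?thesis
      using assms yV w(1) by (subst coset_eq_iff) auto
  qed
  have self: "x \<in> W +>\<^bsub>V\<^esub> x" using assms by (simp add: W.a_rcos_self)
  have "(\<Union>y\<in>W +>\<^bsub>V\<^esub> x. W +>\<^bsub>V\<^esub> (a \<odot>\<^bsub>V\<^esub> y)) = W +>\<^bsub>V\<^esub> (a \<odot>\<^bsub>V\<^esub> x)"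
    by (intro UN_constant_eq[OF self] ballI const)
  then show ?thesis by (simp add: quotient_space_def)
qed

text \<open>
  Every axiom is the image of the same axiom of \<open>V\<close> under the projection \<open>x \<mapsto> W + x\<close>, which is
  onto and commutes with the operations.
\<close>

lemma module_quotient_space: "module R (quotient_space V W)"
proof (rule module_criteria; (intro allI ballI impI; (elim conjE)?)?)
  note q = carrier_quotient_space zero_quotient_space add_quotient_space smult_quotient_space
  let ?Q = "quotient_space V W"
  show "cring R" by (rule V.R.is_cring)
  show "\<zero>\<^bsub>?Q\<^esub> \<in> carrier ?Q" by (auto simp: q)
  fix u v w
  assume "v \<in> carrier ?Q"
  then obtain v' where v: "v' \<in> carrier V" "v = W +>\<^bsub>V\<^esub> v'" by (auto simp: q)
  show "\<exists>n\<in>carrier ?Q. v \<oplus>\<^bsub>?Q\<^esub> n = \<zero>\<^bsub>?Q\<^esub>"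
  proof
    show "v \<oplus>\<^bsub>?Q\<^esub> (W +>\<^bsub>V\<^esub> (\<ominus>\<^bsub>V\<^esub> v')) = \<zero>\<^bsub>?Q\<^esub>"
      using v by (simp add: q V.r_neg)
    show "W +>\<^bsub>V\<^esub> (\<ominus>\<^bsub>V\<^esub> v') \<in> carrier ?Q"
      using v by (simp add: q)
  qed
  show "v \<oplus>\<^bsub>?Q\<^esub> \<zero>\<^bsub>?Q\<^esub> = v" "\<one>\<^bsub>R\<^esub> \<odot>\<^bsub>?Q\<^esub> v = v" using v by (auto simp: q)
  {
    fix a assume a: "a \<in> carrier R"
    show "a \<odot>\<^bsub>?Q\<^esub> v \<in> carrier ?Q" using a v by (auto simp: q)
    fix b assume b: "b \<in> carrier R"
    show "(a \<otimes>\<^bsub>R\<^esub> b) \<odot>\<^bsub>?Q\<^esub> v = a \<odot>\<^bsub>?Q\<^esub> (b \<odot>\<^bsub>?Q\<^esub> v)"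
      "(a \<oplus>\<^bsub>R\<^esub> b) \<odot>\<^bsub>?Q\<^esub> v = a \<odot>\<^bsub>?Q\<^esub> v \<oplus>\<^bsub>?Q\<^esub> b \<odot>\<^bsub>?Q\<^esub> v"
      using a b v by (auto simp: q V.smult_assoc1 V.smult_l_distr)
  }
  assume "w \<in> carrier ?Q"
  then obtain w' where w: "w' \<in> carrier V" "w = W +>\<^bsub>V\<^esub> w'" by (auto simp: q)
  show "v \<oplus>\<^bsub>?Q\<^esub> w \<in> carrier ?Q" "v \<oplus>\<^bsub>?Q\<^esub> w = w \<oplus>\<^bsub>?Q\<^esub> v"
    using v w by (auto simp: q V.a_comm)
  show "a \<odot>\<^bsub>?Q\<^esub> (v \<oplus>\<^bsub>?Q\<^esub> w) = a \<odot>\<^bsub>?Q\<^esub> v \<oplus>\<^bsub>?Q\<^esub> a \<odot>\<^bsub>?Q\<^esub> w" if "a \<in> carrier R" for a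
    using v w that by (auto simp: q V.smult_r_distr)
  assume "u \<in> carrier ?Q"
  then obtain u' where u: "u' \<in> carrier V" "u = W +>\<^bsub>V\<^esub> u'" by (auto simp: q)
  show "v \<oplus>\<^bsub>?Q\<^esub> w \<oplus>\<^bsub>?Q\<^esub> u = v \<oplus>\<^bsub>?Q\<^esub> (w \<oplus>\<^bsub>?Q\<^esub> u)"
    using u v w by (auto simp: q V.a_assoc)
qed

lemma submodule_coset_image:
  assumes "LinearCombinations.submodule R U V"
  shows "LinearCombinations.submodule R ((\<lambda>x. W +>\<^bsub>V\<^esub> x) ` U) (quotient_space V W)"
proof -
  interpret U: LinearCombinations.submodule R U V by fact
  have U: "u \<in> carrier V" if "u \<in> U" for u using that U.subset by blast
  show ?thesis
    by (rule LinearCombinations.submodule.intro)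
      (auto simp: module_quotient_space carrier_quotient_space zero_quotient_space
        add_quotient_space smult_quotient_space U)
qed

end

text \<open>
  A dual family of functionals would certify that a spanning family is a basis.  It suffices to
  give, for each member, a subspace (the kernel of the dual functional) that omits this member and
  contains all others: then no member lies in the span of the others.  In a quotient such
  subspaces are easier to write down than functionals, which would have to be defined on cosets.
\<close>

lemma (in vectorspace) dim_eq_card_of_separating:
  assumes fin: "finite I" and b: "b ` I \<subseteq> carrier V" and gen: "span (b ` I) = carrier V"
    and sep: "\<And>i. i \<in> I \<Longrightarrow>
      \<exists>N. LinearCombinations.submodule K N V \<and> b i \<notin> N \<and> b ` (I - {i}) \<subseteq> N"
  shows "dim = card I"
proof -
  have inj: "inj_on b I"
  proof (rule inj_onI, rule ccontr)
    fix i j assume "i \<in> I" "j \<in> I" "b i = b j" "i \<noteq> j"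
    then show False using sep[of i] by blast
  qed
  have "lin_indpt (b ` I)"
  proof
    assume "lin_dep (b ` I)"
    then obtain i where i: "i \<in> I" "b i \<in> span (b ` I - {b i})"
      using lindep_span[OF b] fin by auto
    obtain N where N: "LinearCombinations.submodule K N V" "b i \<notin> N" "b ` (I - {i}) \<subseteq> N"
      using sep[OF i(1)] by blast
    have "b ` I - {b i} \<subseteq> N" using N(3) by auto
    then show False using span_is_subset[OF _ N(1)] i(2) N(2) by blast
  qed
  then have "basis (b ` I)" using gen b by (simp add: basis_def)
  then have "dim = card (b ` I)" using fin dim_basis[of "b ` I"] by blast
  then show ?thesis using inj by (simp add: card_image)
qed

section \<open>Chains with coefficients in the two-element field\<close>

text \<open>
  Rewriting sums and products of bits into bitwise connectives would hide the ring laws on which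
  all computations with chains rest.
\<close>

declare add_bit_eq_xor [simp del] mult_bit_eq_and [simp del]

text \<open>
  The tool for additivity of every map on chains that is given by a sum over the support: although
  the support of \<open>c + d\<close> may be smaller than the union of the supports, all three sums can be taken
  over that union.
\<close>

lemma keys_sum_add:
  fixes g :: "'k \<Rightarrow> 'b::comm_monoid_add \<Rightarrow> 'c::comm_monoid_add"
  assumes "\<And>k. g k 0 = 0" "\<And>k x y. g k (x + y) = g k x + g k y"
  shows "(\<Sum>k\<in>Poly_Mapping.keys (c + d). g k (Poly_Mapping.lookup (c + d) k)) =
    (\<Sum>k\<in>Poly_Mapping.keys c. g k (Poly_Mapping.lookup c k)) +
    (\<Sum>k\<in>Poly_Mapping.keys d. g k (Poly_Mapping.lookup d k))"
proof -
  let ?S = "Poly_Mapping.keys c \<union> Poly_Mapping.keys d"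
  have *: "(\<Sum>k\<in>Poly_Mapping.keys e. g k (Poly_Mapping.lookup e k)) =
      (\<Sum>k\<in>?S. g k (Poly_Mapping.lookup e k))" if "Poly_Mapping.keys e \<subseteq> ?S" for e
    using that by (intro sum.mono_neutral_left) (auto simp: assms(1) in_keys_iff)
  show ?thesis
    unfolding *[OF Poly_Mapping.keys_add] *[OF Un_upper1] *[OF Un_upper2]
    by (simp add: lookup_add assms(2) sum.distrib)
qed

lemma boundary_add: "boundary p (c + d) = boundary p c + boundary p d"
  unfolding boundary_def
  by (auto intro!: keys_sum_add simp: single_add sum.distrib)

lemma boundary_zero [simp]: "boundary p 0 = 0"
  by (simp add: boundary_def)

lemma map_mult_bit: "Poly_Mapping.map ((*) a) c = (if a = 0 then 0 else c)" for a :: bit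
  by (cases a; intro poly_mapping_eqI) (auto simp: map.rep_eq when_def)

lemma chain_space_simps:
  "carrier (chain_space p K) =
    {c. Poly_Mapping.keys c \<subseteq> {\<sigma> \<in> K. finite \<sigma> \<and> card \<sigma> = Suc p}}"
  "\<zero>\<^bsub>chain_space p K\<^esub> = 0"
  "c \<oplus>\<^bsub>chain_space p K\<^esub> d = c + d"
  "a \<odot>\<^bsub>chain_space p K\<^esub> c = (if a = 0 then 0 else c)"
  by (auto simp: chain_space_def map_mult_bit)

text \<open>
  In characteristic two every chain is its own negative, so differences are sums.
\<close>

lemma chain_add_self: "c + c = 0" for c :: "'k \<Rightarrow>\<^sub>0 bit"
  by (rule poly_mapping_eqI) (simp add: lookup_add)

lemma module_chain_space: "module class_ring (chain_space p K)"
proof (rule module_criteria; (intro allI ballI impI; (elim conjE)?)?)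
  show "cring (class_ring :: bit ring)" ..
next
  fix v assume "v \<in> carrier (chain_space p K)"
  then show "\<exists>n\<in>carrier (chain_space p K). v \<oplus>\<^bsub>chain_space p K\<^esub> n = \<zero>\<^bsub>chain_space p K\<^esub>"
    by (intro bexI[of _ v]) (auto simp: chain_space_simps chain_add_self)
next
  fix v w :: "'a set \<Rightarrow>\<^sub>0 bit"
  assume "v \<in> carrier (chain_space p K)" "w \<in> carrier (chain_space p K)"
  then show "v \<oplus>\<^bsub>chain_space p K\<^esub> w \<in> carrier (chain_space p K)"
    using Poly_Mapping.keys_add[of v w] by (auto simp: chain_space_simps)
next
  fix a b :: bit and v :: "'a set \<Rightarrow>\<^sub>0 bit"
  show "(a \<oplus>\<^bsub>class_ring\<^esub> b) \<odot>\<^bsub>chain_space p K\<^esub> v =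
      a \<odot>\<^bsub>chain_space p K\<^esub> v \<oplus>\<^bsub>chain_space p K\<^esub> b \<odot>\<^bsub>chain_space p K\<^esub> v"
    by (cases a; cases b) (auto simp: chain_space_simps chain_add_self)
qed (auto simp: chain_space_simps add.commute add.assoc)

lemma chain_zero_closed: "0 \<in> carrier (chain_space p K)"
  by (simp add: chain_space_simps)

lemma chain_add_closed:
  assumes "c \<in> carrier (chain_space p K)" "d \<in> carrier (chain_space p K)"
  shows "c + d \<in> carrier (chain_space p K)"
  using assms Poly_Mapping.keys_add[of c d] by (auto simp: chain_space_simps)

text \<open>
  The scalars are \<open>0\<close> and \<open>1\<close>, so a set that contains \<open>0\<close> is closed under scalar multiples.
\<close>

lemma chain_submoduleI:
  assumes "N \<subseteq> carrier (chain_space p K)" "0 \<in> N" "\<And>c d. c \<in> N \<Longrightarrow> d \<in> N \<Longrightarrow> c + d \<in> N"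
  shows "LinearCombinations.submodule class_ring N (chain_space p K)"
  using assms
  by (intro LinearCombinations.submodule.intro) (auto simp: module_chain_space chain_space_simps)

lemma cycle_space_0: "cycle_space 0 K = chain_space 0 K"
  by (simp add: cycle_space_def boundary_def chain_space_def)

lemma chain_space_induct [consumes 1, case_names zero simplex add]:
  assumes "c \<in> carrier (chain_space p K)"
    and "P 0"
    and "\<And>\<sigma>. \<sigma> \<in> K \<Longrightarrow> finite \<sigma> \<Longrightarrow> card \<sigma> = Suc p \<Longrightarrow> P (Poly_Mapping.single \<sigma> 1)"
    and "\<And>c d. c \<in> carrier (chain_space p K) \<Longrightarrow> d \<in> carrier (chain_space p K) \<Longrightarrow>
      P c \<Longrightarrow> P d \<Longrightarrow> P (c + d)"
  shows "P c"
  using assms(1)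
proof (induction c rule: update_induct)
  case const
  show ?case by (rule assms(2))
next
  case (update f \<sigma> a)
  have a: "a = 1" using update.hyps(2) by simp
  have eq: "Poly_Mapping.update \<sigma> a f = Poly_Mapping.single \<sigma> 1 + f"
    using update.hyps(1)
    by (intro poly_mapping_eqI) (auto simp: a lookup_update lookup_add lookup_single in_keys_iff when_def)
  have keys: "Poly_Mapping.keys (Poly_Mapping.update \<sigma> a f) = insert \<sigma> (Poly_Mapping.keys f)"
    using a by (auto simp: in_keys_iff lookup_update split: if_splits)
  have f: "f \<in> carrier (chain_space p K)" and \<sigma>: "\<sigma> \<in> K" "finite \<sigma>" "card \<sigma> = Suc p"
    using update.prems by (auto simp: keys chain_space_simps)
  show ?case
    unfolding eq using f \<sigma> assms(3) update.IH[OF f]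
    by (intro assms(4)) (auto simp: chain_space_simps)
qed

lemma chain_minus:
  assumes "c \<in> carrier (chain_space p K)" "d \<in> carrier (chain_space p K)"
  shows "c \<ominus>\<^bsub>chain_space p K\<^esub> d = c + d"
proof -
  interpret module class_ring "chain_space p K" by (rule module_chain_space)
  have "\<ominus>\<^bsub>chain_space p K\<^esub> d = d"
    using assms(2) by (intro M.minus_equality) (auto simp: chain_space_simps chain_add_self)
  then show ?thesis by (simp add: a_minus_def chain_space_simps)
qed

lemma boundary_edge:
  assumes "u \<noteq> v"
  shows "boundary (Suc 0) (Poly_Mapping.single {u, v} a) =
    Poly_Mapping.single {u} a + Poly_Mapping.single {v} a"
proof -
  have "{u, v} - {u} = {v}" "{u, v} - {v} = {u}" using assms by auto
  then show ?thesis using assms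
    by (cases "a = 0") (auto simp: boundary_def add.commute)
qed

definition adjacent :: "'v set set \<Rightarrow> ('v \<times> 'v) set" where
  "adjacent K = {(u, v). u \<noteq> v \<and> {u, v} \<in> K}"

lemma sym_adjacent: "sym (adjacent K)"
  by (auto simp: sym_def adjacent_def insert_commute)

text \<open>
  A simplex of dimension one is a pair of distinct adjacent vertices, so induction over
  one-dimensional chains only needs the elementary chain of such a pair.
\<close>

lemma edge_chain_induct [consumes 1, case_names zero edge add]:
  assumes "c \<in> carrier (chain_space (Suc 0) K)"
    and "P 0"
    and "\<And>u v. (u, v) \<in> adjacent K \<Longrightarrow> P (Poly_Mapping.single {u, v} 1)"
    and "\<And>c d. P c \<Longrightarrow> P d \<Longrightarrow> P (c + d)"
  shows "P c"
  using assms(1)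
proof (induction rule: chain_space_induct)
  case (simplex \<sigma>)
  then obtain u v where "\<sigma> = {u, v}" "u \<noteq> v" by (auto simp: card_Suc_eq)
  then show ?case using simplex assms(3)[of u v] by (simp add: adjacent_def)
qed (auto intro: assms)

lemma boundaries_0_submodule:
  assumes faces: "\<And>u v. {u, v} \<in> K \<Longrightarrow> {v} \<in> K"
  shows "LinearCombinations.submodule class_ring (boundaries 0 K) (chain_space 0 K)"
proof (rule chain_submoduleI)
  show "boundaries 0 K \<subseteq> carrier (chain_space 0 K)"
  proof (unfold boundaries_def, rule image_subsetI)
    fix c assume "c \<in> carrier (chain_space (Suc 0) K)"
    then show "boundary (Suc 0) c \<in> carrier (chain_space 0 K)"
    proof (induction rule: edge_chain_induct)
      case zero
      show ?case by (simp add: chain_space_simps)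
    next
      case (edge u v)
      then have "{u} \<in> K" "{v} \<in> K"
        using faces[of u v] faces[of v u] by (auto simp: adjacent_def insert_commute)
      then show ?case
        using edge by (auto simp: adjacent_def boundary_edge intro!: chain_add_closed) (auto simp: chain_space_simps)
    next
      case (add c d)
      then show ?case by (simp add: boundary_add chain_add_closed)
    qed
  qed
  show "0 \<in> boundaries 0 K"
    by (auto simp: boundaries_def chain_space_simps intro!: image_eqI[of _ _ 0])
  show "c + d \<in> boundaries 0 K" if "c \<in> boundaries 0 K" "d \<in> boundaries 0 K" for c d
    using that by (auto simp: boundaries_def boundary_add[symmetric] intro!: imageI chain_add_closed)
qed

text \<open>
  The number of vertices of a zero-dimensional chain that lie in \<open>B\<close>, modulo two.
\<close>

definition parity_on :: "'v set \<Rightarrow> ('v set \<Rightarrow>\<^sub>0 bit) \<Rightarrow> bit" where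
  "parity_on B c = (\<Sum>\<sigma>\<in>Poly_Mapping.keys c. if \<sigma> \<subseteq> B then Poly_Mapping.lookup c \<sigma> else 0)"

lemma parity_on_add: "parity_on B (c + d) = parity_on B c + parity_on B d"
  unfolding parity_on_def by (rule keys_sum_add) auto

lemma parity_on_zero [simp]: "parity_on B 0 = 0"
  by (simp add: parity_on_def)

lemma parity_on_single [simp]: "parity_on B (Poly_Mapping.single {v} 1) = of_bool (v \<in> B)"
  by (simp add: parity_on_def)

text \<open>
  If \<open>B\<close> is a union of components, then every edge has both or none of its endpoints in \<open>B\<close>,
  so its boundary contributes an even number.
\<close>

lemma parity_on_boundary:
  assumes "c \<in> boundaries 0 K" and closed: "\<And>u v. (u, v) \<in> adjacent K \<Longrightarrow> u \<in> B \<longleftrightarrow> v \<in> B"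
  shows "parity_on B c = 0"
proof -
  obtain e where e: "e \<in> carrier (chain_space (Suc 0) K)" and c: "c = boundary (Suc 0) e"
    using assms(1) by (auto simp: boundaries_def)
  from e have "parity_on B (boundary (Suc 0) e) = 0"
  proof (induction rule: edge_chain_induct)
    case (edge u v)
    then show ?case
      using closed[OF edge] by (simp add: boundary_edge parity_on_add adjacent_def)
  qed (auto simp: boundary_add parity_on_add)
  then show ?thesis by (simp add: c)
qed

text \<open>
  Along a walk from \<open>u\<close> to \<open>v\<close> the boundaries of the edges add up to \<open>u + v\<close>, because each
  intermediate vertex is counted twice.
\<close>

lemma vertices_homologous:
  assumes "(u, v) \<in> (adjacent K)\<^sup>*" and faces: "\<And>u v. {u, v} \<in> K \<Longrightarrow> {v} \<in> K"
  shows "Poly_Mapping.single {u} 1 + Poly_Mapping.single {v} 1 \<in> boundaries 0 K"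
  using assms(1)
proof (induction rule: rtrancl_induct)
  interpret LinearCombinations.submodule class_ring "boundaries 0 K" "chain_space 0 K"
    by (rule boundaries_0_submodule) (rule faces)
  case base
  show ?case using zero_closed by (simp add: chain_add_self chain_space_simps)
  case (step v w)
  have "Poly_Mapping.single {v} 1 + Poly_Mapping.single {w} 1 =
      boundary (Suc 0) (Poly_Mapping.single {v, w} 1)"
    using step.hyps(2) by (simp add: boundary_edge adjacent_def)
  also have "\<dots> \<in> boundaries 0 K"
    using step.hyps(2) by (auto simp: boundaries_def chain_space_simps adjacent_def)
  finally have "(Poly_Mapping.single {u} 1 + Poly_Mapping.single {v} 1) +
      (Poly_Mapping.single {v} 1 + Poly_Mapping.single {w} (1::bit)) \<in> boundaries 0 K"
    using m_closed[OF step.IH] by (simp add: chain_space_simps)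
  also have "(Poly_Mapping.single {u} 1 + Poly_Mapping.single {v} 1) +
      (Poly_Mapping.single {v} 1 + Poly_Mapping.single {w} (1::bit)) =
      Poly_Mapping.single {u} 1 + (Poly_Mapping.single {v} 1 + Poly_Mapping.single {v} 1) +
        Poly_Mapping.single {w} 1"
    by (simp only: add.assoc)
  finally show ?case by (simp only: chain_add_self add_0_right)
qed


section \<open>Persistent homology in degree zero\<close>

text \<open>
  Two cycles of \<open>K\<close> with the same class differ by a boundary of \<open>K\<close>, which is also a boundary of \<open>L\<close>.
\<close>

lemma homology_incl_0_coset:
  assumes "K \<subseteq> L" "\<And>u v. {u, v} \<in> K \<Longrightarrow> {v} \<in> K" "\<And>u v. {u, v} \<in> L \<Longrightarrow> {v} \<in> L"
    and x: "x \<in> carrier (chain_space 0 K)"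
  shows "homology_incl 0 L (boundaries 0 K +>\<^bsub>chain_space 0 K\<^esub> x) =
    boundaries 0 L +>\<^bsub>chain_space 0 L\<^esub> x"
proof -
  have BK: "LinearCombinations.submodule class_ring (boundaries 0 K) (chain_space 0 K)"
    by (rule boundaries_0_submodule) (rule assms(2))
  have BL: "LinearCombinations.submodule class_ring (boundaries 0 L) (chain_space 0 L)"
    by (rule boundaries_0_submodule) (rule assms(3))
  interpret BK: LinearCombinations.submodule class_ring "boundaries 0 K" "chain_space 0 K" by (rule BK)
  interpret BL: LinearCombinations.submodule class_ring "boundaries 0 L" "chain_space 0 L" by (rule BL)
  have KL: "carrier (chain_space p K) \<subseteq> carrier (chain_space p L)" for p
    using assms(1) by (auto simp: chain_space_simps)
  then have B: "boundaries 0 K \<subseteq> boundaries 0 L"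
    by (auto simp: boundaries_def)
  have xL: "x \<in> carrier (chain_space 0 L)" using x KL by blast
  have coset: "boundaries 0 K +>\<^bsub>chain_space 0 K\<^esub> x = (\<lambda>b. b + x) ` boundaries 0 K"
    by (auto simp: a_r_coset_def' chain_space_simps)
  have "boundaries 0 L +>\<^bsub>chain_space 0 L\<^esub> (b + x) = boundaries 0 L +>\<^bsub>chain_space 0 L\<^esub> x"
    if "b \<in> boundaries 0 K" for b
  proof -
    have b: "b \<in> boundaries 0 L" using that B by blast
    then have "b \<in> carrier (chain_space 0 L)" using BL.subset by blast
    then have bx: "b + x \<in> carrier (chain_space 0 L)"
      using xL by (rule chain_add_closed)
    then have "b + x \<ominus>\<^bsub>chain_space 0 L\<^esub> x = b"
      using xL by (simp add: chain_minus add.assoc chain_add_self)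
    then show ?thesis using b by (subst coset_eq_iff[OF BL bx xL]) simp
  qed
  moreover have "boundaries 0 K \<noteq> {}" using BK.zero_closed by blast
  ultimately have "(\<lambda>z. boundaries 0 L +>\<^bsub>chain_space 0 L\<^esub> z) `
      (boundaries 0 K +>\<^bsub>chain_space 0 K\<^esub> x) = {boundaries 0 L +>\<^bsub>chain_space 0 L\<^esub> x}"
    unfolding coset by (auto simp: image_image)
  then show ?thesis by (simp add: homology_incl_def cycle_space_0)
qed

text \<open>
  In degree zero the image of \<open>H\<^sub>0(K) \<rightarrow> H\<^sub>0(L)\<close> has as dimension the number of components of \<open>L\<close>
  that contain a vertex of \<open>K\<close>.  Here \<open>R\<close> is a system of representatives in \<open>K\<close> of these
  components, and their classes form a basis.  They span, since a vertex of \<open>K\<close> is homologous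
  in \<open>L\<close> to its representative.  They are independent, since the parity of a chain on the
  component of \<open>r\<close> vanishes on boundaries and on all representatives other than \<open>r\<close>.
\<close>

theorem persistent_betti_0_eq_card:
  assumes KL: "K \<subseteq> L"
    and facesK: "\<And>u v. {u, v} \<in> K \<Longrightarrow> {v} \<in> K" and facesL: "\<And>u v. {u, v} \<in> L \<Longrightarrow> {v} \<in> L"
    and fin: "finite R" and RK: "\<And>r. r \<in> R \<Longrightarrow> {r} \<in> K"
    and cover: "\<And>v. {v} \<in> K \<Longrightarrow> \<exists>r\<in>R. (r, v) \<in> (adjacent L)\<^sup>*"
    and sep: "\<And>r r'. r \<in> R \<Longrightarrow> r' \<in> R \<Longrightarrow> (r, r') \<in> (adjacent L)\<^sup>* \<Longrightarrow> r = r'"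
  shows "persistent_betti 0 K L = card R"
proof -
  let ?C = "chain_space 0 L" and ?CK = "chain_space 0 K" and ?W = "boundaries 0 L"
  define cls where "cls x = ?W +>\<^bsub>?C\<^esub> x" for x
  define Q where "Q = quotient_space ?C ?W"
  let ?V = "Q\<lparr>carrier := cls ` carrier ?CK\<rparr>"
  define b where "b r = cls (Poly_Mapping.single {r} 1)" for r
  have WK: "LinearCombinations.submodule class_ring (boundaries 0 K) ?CK"
    by (rule boundaries_0_submodule) (rule facesK)
  have W: "LinearCombinations.submodule class_ring ?W ?C"
    by (rule boundaries_0_submodule) (rule facesL)
  interpret Q: module class_ring Q unfolding Q_def by (rule module_quotient_space[OF W])
  have sub: "LinearCombinations.submodule class_ring (cls ` U) Q"
    if "LinearCombinations.submodule class_ring U ?C" for U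
    unfolding Q_def cls_def by (rule submodule_coset_image[OF W that])
  have C_sub: "carrier ?CK \<subseteq> carrier ?C" using KL by (auto simp: chain_space_simps)
  have sub_CK: "LinearCombinations.submodule class_ring (carrier ?CK) ?C"
    using C_sub by (intro chain_submoduleI chain_zero_closed chain_add_closed)
  have cls_add: "cls c \<oplus>\<^bsub>Q\<^esub> cls d = cls (c + d)" if "c \<in> carrier ?CK" "d \<in> carrier ?CK" for c d
    using add_quotient_space[OF W, of c d] that C_sub
    by (auto simp: Q_def cls_def chain_space_simps(3))
  have cls_eq: "cls c = cls d \<longleftrightarrow> c + d \<in> ?W" if "c \<in> carrier ?CK" "d \<in> carrier ?CK" for c d
    using coset_eq_iff[OF W, of c d] chain_minus[of c 0 L d] that C_sub by (auto simp: cls_def)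
  have single: "Poly_Mapping.single {v} 1 \<in> carrier ?CK" if "{v} \<in> K" for v
    using that by (simp add: chain_space_simps)
  have module_V: "module class_ring ?V"
    by (rule Q.submodule_is_module[OF sub[OF sub_CK]])
  interpret V: vectorspace class_ring ?V
    by (intro vectorspace.intro module_V class_field)
  have sub_V: "LinearCombinations.submodule class_ring (cls ` U) ?V"
    if "LinearCombinations.submodule class_ring U ?C" "U \<subseteq> carrier ?CK" for U
  proof -
    interpret U: LinearCombinations.submodule class_ring "cls ` U" Q by (rule sub[OF that(1)])
    show ?thesis
      using that(2) U.m_closed U.zero_closed U.smult_closed
      by (intro LinearCombinations.submodule.intro module_V) auto
  qed
  have bV: "b ` R \<subseteq> carrier ?V" using single RK by (auto simp: b_def)
  have "V.dim = card R"
  proof (rule V.dim_eq_card_of_separating[OF fin bV])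
    interpret S: LinearCombinations.submodule class_ring "V.span (b ` R)" ?V
      by (rule V.span_is_submodule[OF bV])
    have "cls c \<in> V.span (b ` R)" if "c \<in> carrier ?CK" for c
      using that
    proof (induction rule: chain_space_induct)
      case zero
      have "cls 0 = \<zero>\<^bsub>Q\<^esub>"
        using zero_quotient_space[OF W] by (simp add: cls_def Q_def chain_space_simps(2))
      then show ?case using S.zero_closed by simp
    next
      case (simplex \<sigma>)
      then obtain v where v: "\<sigma> = {v}" "{v} \<in> K" by (auto simp: card_Suc_eq)
      then obtain r where r: "r \<in> R" "(r, v) \<in> (adjacent L)\<^sup>*" using cover by blast
      have "cls (Poly_Mapping.single {v} 1) = b r"
        using vertices_homologous[OF r(2) facesL] v(2) RK[OF r(1)] single
        by (simp add: b_def cls_eq add.commute)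
      then show ?case using V.span_mem[OF bV] r(1) v(1) by auto
    next
      case (add c d)
      then show ?case using S.m_closed[of "cls c" "cls d"] by (simp add: cls_add)
    qed
    then show "V.span (b ` R) = carrier ?V"
      using V.span_is_subset2[OF bV] by auto
  next
    fix r assume r: "r \<in> R"
    define B where "B = (adjacent L)\<^sup>* `` {r}"
    have closed: "u \<in> B \<longleftrightarrow> v \<in> B" if "(u, v) \<in> adjacent L" for u v
      using that sym_adjacent[of L] unfolding B_def by (auto dest: symD intro: rtrancl_into_rtrancl)
    \<comment> \<open>the kernel, among the chains of \<open>K\<close>, of the functional dual to \<open>r\<close>\<close>
    define U where "U = {c \<in> carrier ?CK. parity_on B c = 0}"
    have U: "U \<subseteq> carrier ?CK" by (auto simp: U_def)
    have "LinearCombinations.submodule class_ring U ?C"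
      using U C_sub
      by (intro chain_submoduleI) (auto simp: U_def parity_on_add intro: chain_zero_closed chain_add_closed)
    then have "LinearCombinations.submodule class_ring (cls ` U) ?V" using sub_V U by blast
    moreover have "b r \<notin> cls ` U"
    proof
      assume "b r \<in> cls ` U"
      then obtain c where c: "c \<in> U" "b r = cls c" by blast
      then have "Poly_Mapping.single {r} 1 + c \<in> ?W"
        using cls_eq single[OF RK[OF r]] U by (auto simp: b_def)
      then have "parity_on B (Poly_Mapping.single {r} 1 + c) = 0"
        using closed by (rule parity_on_boundary)
      then show False using c(1) by (simp add: parity_on_add U_def B_def)
    qed
    moreover have "b ` (R - {r}) \<subseteq> cls ` U"
    proof (rule image_subsetI)
      fix r' assume r': "r' \<in> R - {r}"
      then have "r' \<notin> B" using sep[OF r] by (auto simp: B_def)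
      then show "b r' \<in> cls ` U" using r' RK single by (auto simp: b_def U_def)
    qed
    ultimately show "\<exists>N. LinearCombinations.submodule class_ring N ?V \<and> b r \<notin> N \<and> b ` (R - {r}) \<subseteq> N"
      by blast
  qed
  moreover have "homology_incl 0 L ` carrier (homology 0 K) = cls ` carrier ?CK"
    unfolding homology_def cycle_space_0 carrier_quotient_space[OF WK] image_image cls_def
    by (intro image_cong refl homology_incl_0_coset KL facesK facesL)
  ultimately show ?thesis
    by (simp add: persistent_betti_def homology_def cycle_space_0 Q_def)
qed


section \<open>Sublevel complexes of the path\<close>

lemma sublevel_complex_iff:
  "\<sigma> \<in> sublevel_complex x n t \<longleftrightarrow> \<sigma> \<in> path_complex \<and> (\<forall>k\<in>\<sigma>. truncated x n k \<le> t)"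
proof -
  have "finite \<sigma>" "\<sigma> \<noteq> {}" if "\<sigma> \<in> path_complex"
    using that by (auto simp: path_complex_def)
  then show ?thesis by (auto simp: sublevel_complex_def)
qed

lemma vertex_sublevel_iff: "{k} \<in> sublevel_complex x n t \<longleftrightarrow> truncated x n k \<le> t"
  by (auto simp: sublevel_complex_iff path_complex_def)

lemma sublevel_complex_faces: "{u, v} \<in> sublevel_complex x n t \<Longrightarrow> {v} \<in> sublevel_complex x n t"
  by (simp add: vertex_sublevel_iff) (simp add: sublevel_complex_iff)

lemma adjacent_sublevel_iff:
  "(i, j) \<in> adjacent (sublevel_complex x n t) \<longleftrightarrow>
    (j = Suc i \<or> i = Suc j) \<and> truncated x n i \<le> t \<and> truncated x n j \<le> t"
  by (auto simp: adjacent_def sublevel_complex_iff path_complex_def doubleton_eq_iff)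

text \<open>
  The path has no detours: a walk from \<open>i\<close> to \<open>j\<close> visits every vertex between them.
\<close>

lemma connected_imp_between_le:
  assumes "(i, j) \<in> (adjacent (sublevel_complex x n t))\<^sup>*" "i \<noteq> j" "min i j \<le> k" "k \<le> max i j"
  shows "truncated x n k \<le> t"
  using assms
proof (induction arbitrary: k rule: rtrancl_induct)
  case (step u v)
  then have *: "v = Suc u \<or> u = Suc v" "truncated x n u \<le> t" "truncated x n v \<le> t"
    by (auto simp: adjacent_sublevel_iff)
  show ?case
  proof (cases "k = u \<or> k = v")
    case False
    then have "i \<noteq> u" "min i u \<le> k" "k \<le> max i u" using step.prems *(1) by auto
    then show ?thesis by (rule step.IH)
  qed (use * in auto)
qed simp

lemma between_le_imp_connected:
  assumes "i \<le> j" "\<And>k. i \<le> k \<Longrightarrow> k \<le> j \<Longrightarrow> truncated x n k \<le> t"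
  shows "(i, j) \<in> (adjacent (sublevel_complex x n t))\<^sup>*"
  using assms
proof (induction j rule: dec_induct)
  case (step j)
  then have "(j, Suc j) \<in> adjacent (sublevel_complex x n t)"
    by (auto simp: adjacent_sublevel_iff)
  with step show ?case by (auto intro: rtrancl_into_rtrancl)
qed simp

text \<open>
  The first vertex with value at most \<open>s\<close> in its component of the sublevel complex at level \<open>t\<close>:
  every earlier vertex with value at most \<open>s\<close> is cut off by a value above \<open>t\<close>.
\<close>

definition leaders :: "(nat \<Rightarrow> real) \<Rightarrow> nat \<Rightarrow> ereal \<Rightarrow> ereal \<Rightarrow> nat set" where
  "leaders x n s t = {k. truncated x n k \<le> s \<and>
    (\<forall>j<k. truncated x n j \<le> s \<longrightarrow> (\<exists>i. j < i \<and> i < k \<and> t < truncated x n i))}"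

text \<open>
  The leaders represent the components of the larger complex that meet the smaller one: walking
  left from a vertex as long as values stay at most \<open>t\<close>, the last vertex seen with value at most
  \<open>s\<close> is a leader, and two leaders in one component would contradict the choice of the later one.
\<close>

lemma sublevel_betti_eq_card_leaders:
  assumes st: "s \<le> t" and fin: "finite (leaders x n s t)"
  shows "sublevel_betti 0 x n s t = card (leaders x n s t)"
  unfolding sublevel_betti_def
proof (rule persistent_betti_0_eq_card[OF _ _ _ fin])
  let ?tr = "truncated x n" and ?E = "adjacent (sublevel_complex x n t)"
  show "sublevel_complex x n s \<subseteq> sublevel_complex x n t"
    using order_trans[OF _ st] by (intro subsetI) (simp add: sublevel_complex_iff)
  show "{r} \<in> sublevel_complex x n s" if "r \<in> leaders x n s t" for r
    using that by (simp add: leaders_def vertex_sublevel_iff)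
  fix v assume "{v} \<in> sublevel_complex x n s"
  then have v: "?tr v \<le> s" by (simp add: vertex_sublevel_iff)
  \<comment> \<open>\<open>P r\<close>: the vertex \<open>r\<close> lies at level \<open>s\<close> and is joined to \<open>v\<close>
    from the left at level \<open>t\<close>; the least such \<open>r\<close> is a leader\<close>
  define P where "P r \<longleftrightarrow> ?tr r \<le> s \<and> r \<le> v \<and> (\<forall>k. r \<le> k \<and> k \<le> v \<longrightarrow> ?tr k \<le> t)" for r
  define r where "r = (LEAST r. P r)"
  have "?tr v \<le> t" using v st by (rule order_trans)
  then have "P v" using v by (auto simp: P_def dest: order_antisym[of v])
  then have "P r" unfolding r_def by (rule LeastI)
  then have r: "?tr r \<le> s" "r \<le> v" "\<And>k. r \<le> k \<Longrightarrow> k \<le> v \<Longrightarrow> ?tr k \<le> t"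
    by (auto simp: P_def)
  have "\<exists>i. j < i \<and> i < r \<and> t < ?tr i" if "j < r" "?tr j \<le> s" for j
  proof (rule ccontr)
    assume *: "\<not> ?thesis"
    have "?tr k \<le> t" if "j \<le> k" "k \<le> v" for k
    proof (cases "k = j \<or> r \<le> k")
      case True
      then show ?thesis using r(3) \<open>?tr j \<le> s\<close> st \<open>k \<le> v\<close> by auto
    next
      case False
      then show ?thesis using * \<open>j \<le> k\<close> by (metis not_le order_le_less)
    qed
    then have "P j" using that r(2) by (simp add: P_def)
    then show False using \<open>j < r\<close> not_less_Least[of j P] by (simp add: r_def)
  qed
  then have "r \<in> leaders x n s t" using r(1) by (auto simp: leaders_def)
  moreover have "(r, v) \<in> ?E\<^sup>*" using r by (intro between_le_imp_connected) auto
  ultimately show "\<exists>r\<in>leaders x n s t. (r, v) \<in> ?E\<^sup>*" by blast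
next
  fix r r' assume rr': "r \<in> leaders x n s t" "r' \<in> leaders x n s t"
    and conn: "(r, r') \<in> (adjacent (sublevel_complex x n t))\<^sup>*"
  have between: "truncated x n k \<le> t" if "r \<noteq> r'" "min r r' < k" "k < max r r'" for k
    using connected_imp_between_le[OF conn] that by auto
  have gap: "\<exists>i. m < i \<and> i < m' \<and> t < truncated x n i"
    if "m \<in> leaders x n s t" "m' \<in> leaders x n s t" "m < m'" for m m'
    using that by (auto simp: leaders_def)
  show "r = r'"
  proof (rule linorder_cases[of r r'])
    assume "r < r'"
    then show ?thesis using gap[OF rr'] between by force
  next
    assume "r' < r"
    then show ?thesis using gap[OF rr'(2,1)] between by force
  qed
qed (auto intro: sublevel_complex_faces)

lemma sublevel_betti_top: "sublevel_betti 0 x n \<infinity> \<infinity> = 1"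
proof -
  have "leaders x n \<infinity> \<infinity> = {0}" by (auto simp: leaders_def)
  then show ?thesis using sublevel_betti_eq_card_leaders[of \<infinity> \<infinity> x n] by simp
qed

text \<open>
  Looking left from position \<open>k + 1\<close>: a value above \<open>t\<close> or the left end of the sequence is met
  before any value at most \<open>s\<close>.  The recursion on \<open>k\<close> is what yields a recursion for the
  probability.
\<close>

primrec clear :: "ereal \<Rightarrow> ereal \<Rightarrow> (nat \<Rightarrow> real) \<Rightarrow> nat \<Rightarrow> bool" where
  "clear s t x 0 \<longleftrightarrow> True"
| "clear s t x (Suc k) \<longleftrightarrow> s < ereal (x (Suc k)) \<and> (t < ereal (x (Suc k)) \<or> clear s t x k)"

text \<open>
  The condition \<open>s < \<infinity>\<close> enters at vertex \<open>0\<close>, whose value is \<open>\<infinity>\<close>: there the search for values at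
  most \<open>s\<close> ends without success, even if \<open>t = \<infinity>\<close>.
\<close>

lemma clear_iff:
  assumes "s < \<infinity>" "k \<le> n"
  shows "clear s t x k \<longleftrightarrow>
    (\<forall>j\<le>k. truncated x n j \<le> s \<longrightarrow> (\<exists>i. j < i \<and> i \<le> k \<and> t < truncated x n i))"
  using assms(2)
proof (induction k)
  case 0
  then show ?case using assms(1) by (auto simp: truncated_def)
next
  case (Suc k)
  then have tr: "truncated x n (Suc k) = ereal (x (Suc k))" by (simp add: truncated_def)
  have "(\<forall>j\<le>Suc k. truncated x n j \<le> s \<longrightarrow> (\<exists>i. j < i \<and> i \<le> Suc k \<and> t < truncated x n i)) \<longleftrightarrow>
    s < truncated x n (Suc k) \<and> (t < truncated x n (Suc k) \<or>
      (\<forall>j\<le>k. truncated x n j \<le> s \<longrightarrow> (\<exists>i. j < i \<and> i \<le> k \<and> t < truncated x n i)))"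
    by (auto simp: le_Suc_eq not_le[symmetric]) (rule exI[of _ "Suc k"], simp)
  then show ?case using Suc by (simp add: tr)
qed

lemma sublevel_betti_eq_sum:
  assumes s: "s < \<infinity>" and st: "s \<le> t"
  shows "sublevel_betti 0 x n s t = (\<Sum>k<n. of_bool (ereal (x (Suc k)) \<le> s \<and> clear s t x k))"
proof -
  have pos: "1 \<le> k \<and> k \<le> n" if "truncated x n k \<le> s" for k
    using that s by (auto simp: truncated_def split: if_splits)
  have leader_iff: "Suc k \<in> leaders x n s t \<longleftrightarrow> ereal (x (Suc k)) \<le> s \<and> clear s t x k" if "k < n" for k
  proof -
    have "truncated x n (Suc k) = ereal (x (Suc k))" using that by (simp add: truncated_def)
    then show ?thesis using that by (simp add: leaders_def clear_iff[OF s, of k n] less_Suc_eq_le)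
  qed
  have "leaders x n s t = Suc ` {k \<in> {..<n}. ereal (x (Suc k)) \<le> s \<and> clear s t x k}" (is "_ = Suc ` ?A")
  proof (intro equalityI subsetI)
    fix m assume m: "m \<in> leaders x n s t"
    then have "1 \<le> m" "m \<le> n" using pos by (auto simp: leaders_def)
    then obtain k where k: "m = Suc k" "k < n" by (cases m) auto
    then show "m \<in> Suc ` ?A" using m leader_iff by auto
  qed (use leader_iff in auto)
  moreover from this have "finite (leaders x n s t)" by simp
  moreover have "card (Suc ` ?A) = (\<Sum>k<n. of_bool (k \<in> ?A))"
    by (simp add: card_image sum_of_bool_eq Int_def)
  ultimately show ?thesis
    using sublevel_betti_eq_card_leaders[OF st] by simp
qed


section \<open>Probabilities under independence\<close>

lemma clear_cong:
  "(\<And>i. 1 \<le> i \<Longrightarrow> i \<le> k \<Longrightarrow> x i = y i) \<Longrightarrow> clear s t x k = clear s t y k"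
  by (induction k) auto

lemma measurable_clear:
  assumes "{1..k} \<subseteq> I"
  shows "Measurable.pred (PiM I (\<lambda>_. borel)) (\<lambda>x. clear s t x k)"
  using assms
proof (induction k)
  case (Suc k)
  have [measurable]: "(\<lambda>x. x (Suc k)) \<in> borel_measurable (PiM I (\<lambda>_. borel :: real measure))"
    using Suc.prems by (intro measurable_component_singleton) auto
  have [measurable]: "Measurable.pred (PiM I (\<lambda>_. borel)) (\<lambda>x. clear s t x k)"
    using Suc.prems by (intro Suc.IH) auto
  show ?case by simp
qed simp

context prob_space
begin

text \<open>
  The two events depend on \<open>X (k + 1)\<close> and on \<open>X 1, \<dots>, X k\<close>, which are disjoint blocks of an
  independent family.
\<close>

lemma prob_clear_indep:
  assumes X: "indep_vars (\<lambda>_. borel) X {1..}" and A: "A \<in> sets (borel :: real measure)"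
  shows "prob {\<omega> \<in> space M. X (Suc k) \<omega> \<in> A \<and> clear s t (\<lambda>i. X i \<omega>) k} =
    prob {\<omega> \<in> space M. X (Suc k) \<omega> \<in> A} * prob {\<omega> \<in> space M. clear s t (\<lambda>i. X i \<omega>) k}"
proof -
  let ?P = "\<lambda>J. PiM J (\<lambda>_::nat. borel :: real measure)"
  have *: "clear s t (\<lambda>i\<in>{1..k}. X i \<omega>) k = clear s t (\<lambda>i. X i \<omega>) k" for \<omega>
    by (rule clear_cong) simp
  have "indep_var (?P {Suc k}) (\<lambda>\<omega>. \<lambda>i\<in>{Suc k}. X i \<omega>) (?P {1..k}) (\<lambda>\<omega>. \<lambda>i\<in>{1..k}. X i \<omega>)"
    by (rule indep_var_restrict[OF X]) auto
  moreover have "{x \<in> space (?P {Suc k}). x (Suc k) \<in> A} \<in> sets (?P {Suc k})"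
    using A by measurable
  moreover have "{x \<in> space (?P {1..k}). clear s t x k} \<in> sets (?P {1..k})"
    using measurable_clear[of k "{1..k}"] by measurable
  ultimately have "prob ((\<lambda>\<omega>. (\<lambda>i\<in>{Suc k}. X i \<omega>, \<lambda>i\<in>{1..k}. X i \<omega>)) -`
      ({x \<in> space (?P {Suc k}). x (Suc k) \<in> A} \<times> {x \<in> space (?P {1..k}). clear s t x k}) \<inter> space M) =
    prob ((\<lambda>\<omega>. \<lambda>i\<in>{Suc k}. X i \<omega>) -` {x \<in> space (?P {Suc k}). x (Suc k) \<in> A} \<inter> space M) *
    prob ((\<lambda>\<omega>. \<lambda>i\<in>{1..k}. X i \<omega>) -` {x \<in> space (?P {1..k}). clear s t x k} \<inter> space M)"
    by (rule indep_varD)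
  also have "(\<lambda>\<omega>. (\<lambda>i\<in>{Suc k}. X i \<omega>, \<lambda>i\<in>{1..k}. X i \<omega>)) -`
      ({x \<in> space (?P {Suc k}). x (Suc k) \<in> A} \<times> {x \<in> space (?P {1..k}). clear s t x k}) \<inter> space M =
    {\<omega> \<in> space M. X (Suc k) \<omega> \<in> A \<and> clear s t (\<lambda>i. X i \<omega>) k}"
    by (auto simp: * space_PiM simp del: One_nat_def)
  also have "(\<lambda>\<omega>. \<lambda>i\<in>{Suc k}. X i \<omega>) -` {x \<in> space (?P {Suc k}). x (Suc k) \<in> A} \<inter> space M =
    {\<omega> \<in> space M. X (Suc k) \<omega> \<in> A}"
    by (auto simp: space_PiM)
  also have "(\<lambda>\<omega>. \<lambda>i\<in>{1..k}. X i \<omega>) -` {x \<in> space (?P {1..k}). clear s t x k} \<inter> space M =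
    {\<omega> \<in> space M. clear s t (\<lambda>i. X i \<omega>) k}"
    by (auto simp: * space_PiM simp del: One_nat_def)
  finally show ?thesis .
qed

lemma prob_le_eq_extend_cdf:
  assumes "random_variable borel Y" "- \<infinity> < u"
  shows "prob {\<omega> \<in> space M. ereal (Y \<omega>) \<le> u} = extend_cdf (cdf (distr M borel Y)) u"
proof (cases u)
  case (real r)
  have "cdf (distr M borel Y) r = prob (Y -` {..r} \<inter> space M)"
    using assms by (simp add: cdf_def measure_distr)
  also have "Y -` {..r} \<inter> space M = {\<omega> \<in> space M. ereal (Y \<omega>) \<le> u}" using real by auto
  finally show ?thesis using real by (simp add: extend_cdf_def)
qed (use assms in \<open>auto simp: extend_cdf_def prob_space\<close>)

context
  fixes X :: "nat \<Rightarrow> 'a \<Rightarrow> real" and F :: "real \<Rightarrow> real" and s t :: ereal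
  assumes X: "indep_vars (\<lambda>_. borel) X {1..}"
    and F: "\<And>k. 1 \<le> k \<Longrightarrow> cdf (distr M borel (X k)) = F"
    and s: "- \<infinity> < s" and st: "s \<le> t"
begin

lemma random_variable_X: "1 \<le> k \<Longrightarrow> random_variable borel (X k)"
  using X by (simp add: indep_vars_def)

lemma clear_events: "{\<omega> \<in> space M. clear s t (\<lambda>i. X i \<omega>) k} \<in> events"
proof (induction k)
  case (Suc k)
  have [measurable]: "random_variable borel (X (Suc k))" by (rule random_variable_X) simp
  have [measurable]: "Measurable.pred M (\<lambda>\<omega>. clear s t (\<lambda>i. X i \<omega>) k)"
    using Suc by (simp add: pred_def)
  show ?case by simp
qed simp

lemma prob_X_le: "- \<infinity> < u \<Longrightarrow> prob {\<omega> \<in> space M. ereal (X (Suc k) \<omega>) \<le> u} = extend_cdf F u"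
  using prob_le_eq_extend_cdf[OF random_variable_X] F by simp

text \<open>
  Position \<open>k + 1\<close> is either above \<open>t\<close>, which settles the matter, or in \<open>(s, t]\<close>, in which case
  the decision is left to the independent past.
\<close>

lemma prob_clear_Suc:
  "prob {\<omega> \<in> space M. clear s t (\<lambda>i. X i \<omega>) (Suc k)} =
    (1 - extend_cdf F t) +
    (extend_cdf F t - extend_cdf F s) * prob {\<omega> \<in> space M. clear s t (\<lambda>i. X i \<omega>) k}"
proof -
  have [measurable]: "random_variable borel (X (Suc k))" by (rule random_variable_X) simp
  have [measurable]: "Measurable.pred M (\<lambda>\<omega>. clear s t (\<lambda>i. X i \<omega>) k)"
    using clear_events by (simp add: pred_def)
  have le: "prob {\<omega> \<in> space M. ereal (X (Suc k) \<omega>) \<le> s} = extend_cdf F s"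
    "prob {\<omega> \<in> space M. ereal (X (Suc k) \<omega>) \<le> t} = extend_cdf F t"
    using prob_X_le s less_le_trans[OF s st] by blast+
  let ?A = "{y. s < ereal y \<and> ereal y \<le> t}"
  have "{\<omega> \<in> space M. clear s t (\<lambda>i. X i \<omega>) (Suc k)} =
      (space M - {\<omega> \<in> space M. ereal (X (Suc k) \<omega>) \<le> t}) \<union>
      {\<omega> \<in> space M. X (Suc k) \<omega> \<in> ?A \<and> clear s t (\<lambda>i. X i \<omega>) k}"
    using st by auto
  also have "prob \<dots> = prob (space M - {\<omega> \<in> space M. ereal (X (Suc k) \<omega>) \<le> t}) +
      prob {\<omega> \<in> space M. X (Suc k) \<omega> \<in> ?A \<and> clear s t (\<lambda>i. X i \<omega>) k}"
    by (rule finite_measure_Union) auto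
  also have "prob (space M - {\<omega> \<in> space M. ereal (X (Suc k) \<omega>) \<le> t}) = 1 - extend_cdf F t"
    by (subst prob_compl) (auto simp: le)
  also have "prob {\<omega> \<in> space M. X (Suc k) \<omega> \<in> ?A \<and> clear s t (\<lambda>i. X i \<omega>) k} =
      prob {\<omega> \<in> space M. X (Suc k) \<omega> \<in> ?A} * prob {\<omega> \<in> space M. clear s t (\<lambda>i. X i \<omega>) k}"
    by (rule prob_clear_indep[OF X]) measurable
  also have "{\<omega> \<in> space M. X (Suc k) \<omega> \<in> ?A} =
      {\<omega> \<in> space M. ereal (X (Suc k) \<omega>) \<le> t} - {\<omega> \<in> space M. ereal (X (Suc k) \<omega>) \<le> s}"
    by auto
  also have "prob \<dots> = extend_cdf F t - extend_cdf F s"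
    using st by (subst finite_measure_Diff) (auto simp: le)
  finally show ?thesis .
qed

text \<open>
  \<open>L\<close> is the fixed point of the affine recursion; the distance to it starts at \<open>1 - L\<close> and is
  multiplied by \<open>F(t) - F(s)\<close> in each step.
\<close>

lemma prob_clear:
  assumes "1 - extend_cdf F t + extend_cdf F s \<noteq> 0"
  defines "L \<equiv> (1 - extend_cdf F t) / (1 - extend_cdf F t + extend_cdf F s)"
  shows "prob {\<omega> \<in> space M. clear s t (\<lambda>i. X i \<omega>) k} =
    L + (1 - L) * (extend_cdf F t - extend_cdf F s) ^ k"
proof (induction k)
  case 0
  then show ?case by (simp add: prob_space)
next
  case (Suc k)
  have "L * (1 - extend_cdf F t + extend_cdf F s) = 1 - extend_cdf F t"
    using assms by simp
  then have "1 - extend_cdf F t + (extend_cdf F t - extend_cdf F s) * L = L"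
    by (simp add: algebra_simps)
  then show ?case
    unfolding prob_clear_Suc Suc by (simp add: distrib_left mult.left_commute)
qed

lemma expectation_leader_count:
  "expectation (\<lambda>\<omega>. \<Sum>k<n. of_bool (ereal (X (Suc k) \<omega>) \<le> s \<and> clear s t (\<lambda>i. X i \<omega>) k)) =
    (\<Sum>k<n. extend_cdf F s * prob {\<omega> \<in> space M. clear s t (\<lambda>i. X i \<omega>) k})"
proof -
  let ?E = "\<lambda>k. {\<omega> \<in> space M. X (Suc k) \<omega> \<in> {y. ereal y \<le> s} \<and> clear s t (\<lambda>i. X i \<omega>) k}"
  have E: "?E k \<in> events" for k
  proof -
    have [measurable]: "random_variable borel (X (Suc k))" by (rule random_variable_X) simp
    have [measurable]: "Measurable.pred M (\<lambda>\<omega>. clear s t (\<lambda>i. X i \<omega>) k)"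
      using clear_events by (simp add: pred_def)
    show ?thesis by simp
  qed
  have "expectation (\<lambda>\<omega>. \<Sum>k<n. of_bool (ereal (X (Suc k) \<omega>) \<le> s \<and> clear s t (\<lambda>i. X i \<omega>) k)) =
      expectation (\<lambda>\<omega>. \<Sum>k<n. indicator (?E k) \<omega>)"
    by (intro Bochner_Integration.integral_cong sum.cong) (auto simp: indicator_def)
  also have "\<dots> = (\<Sum>k<n. prob (?E k))"
    using E by (subst Bochner_Integration.integral_sum) (auto simp: integrable_indicator_iff emeasure_eq_measure)
  also have "\<dots> = (\<Sum>k<n. extend_cdf F s * prob {\<omega> \<in> space M. clear s t (\<lambda>i. X i \<omega>) k})"
    using prob_clear_indep[OF X, of "{y. ereal y \<le> s}" _ s t] prob_X_le[OF s] by simp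
  finally show ?thesis .
qed

end
end


section \<open>Asymptotics of the expected Betti number\<close>

text \<open>
  The geometric terms have a bounded sum, which the division by \<open>n\<close> sends to zero.
\<close>

lemma geometric_mean_tendsto:
  fixes p L q :: real
  assumes "0 \<le> q" "q < 1"
  shows "(\<lambda>n. (\<Sum>k<n. p * (L + (1 - L) * q ^ k)) / real n) \<longlonglongrightarrow> p * L"
proof -
  have "(\<lambda>n. p * L + p * (1 - L) * ((1 - q ^ n) / (1 - q)) * inverse (real n)) \<longlonglongrightarrow>
      p * L + p * (1 - L) * ((1 - 0) / (1 - q)) * 0"
    using assms by (intro tendsto_intros LIMSEQ_power_zero lim_inverse_n) auto
  moreover have "\<forall>\<^sub>F n in sequentially. (\<Sum>k<n. p * (L + (1 - L) * q ^ k)) / real n =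
      p * L + p * (1 - L) * ((1 - q ^ n) / (1 - q)) * inverse (real n)"
    using eventually_gt_at_top[of 0]
  proof eventually_elim
    case (elim n)
    have "(\<Sum>k<n. p * (L + (1 - L) * q ^ k)) = real n * (p * L) + p * (1 - L) * (\<Sum>k<n. q ^ k)"
      by (simp add: distrib_left sum.distrib sum_distrib_left mult.assoc)
    also have "(\<Sum>k<n. q ^ k) = (1 - q ^ n) / (1 - q)"
      using assms by (simp add: sum_gp_strict)
    finally show ?case using elim by (simp add: divide_inverse distrib_right)
  qed
  ultimately show ?thesis by (simp add: tendsto_cong)
qed

theorem proposition3p3:
  fixes M :: "'a measure" and X :: "nat \<Rightarrow> 'a \<Rightarrow> real" and F :: "real \<Rightarrow> real"
    and s t :: ereal
  assumes "prob_space M"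
    and "prob_space.indep_vars M (\<lambda>_. borel) X {1..}"
    and "\<And>k. 1 \<le> k \<Longrightarrow> cdf (distr M borel (X k)) = F"
    and "- \<infinity> < s" and "s \<le> t"
  shows "(extend_cdf F s \<in> {0<..<1} \<longrightarrow>
      (\<lambda>n. prob_space.expectation M (\<lambda>\<omega>. real (sublevel_betti 0 (\<lambda>k. X k \<omega>) n s t)) / real n)
        \<longlonglongrightarrow> (1 - extend_cdf F t) * extend_cdf F s / (1 - extend_cdf F t + extend_cdf F s))
    \<and> (extend_cdf F s \<in> {0, 1} \<longrightarrow>
      (\<lambda>n. prob_space.expectation M (\<lambda>\<omega>. real (sublevel_betti 0 (\<lambda>k. X k \<omega>) n s t)) / real n)
        \<longlonglongrightarrow> 0)"
proof (cases "s = \<infinity>")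
  case True
  interpret prob_space M by fact
  have "t = \<infinity>" using True assms(5) by simp
  then show ?thesis
    using True lim_inverse_n'
    by (simp add: sublevel_betti_top prob_space extend_cdf_def)
next
  case False
  interpret prob_space M by fact
  define p a where "p = extend_cdf F s" and "a = extend_cdf F t"
  define L where "L = (1 - a) / (1 - a + p)"
  let ?g = "\<lambda>k. prob {\<omega> \<in> space M. clear s t (\<lambda>i. X i \<omega>) k}"
  let ?E = "\<lambda>n. expectation (\<lambda>\<omega>. real (sublevel_betti 0 (\<lambda>k. X k \<omega>) n s t))"
  have [measurable]: "random_variable borel (X (Suc 0))"
    using random_variable_X[OF assms(2-5), of "Suc 0"] by simp
  have p: "p = prob {\<omega> \<in> space M. ereal (X (Suc 0) \<omega>) \<le> s}"
    and a: "a = prob {\<omega> \<in> space M. ereal (X (Suc 0) \<omega>) \<le> t}"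
    unfolding p_def a_def
    using prob_X_le[OF assms(2-5)] assms(4) less_le_trans[OF assms(4,5)] by metis+
  have "p \<le> a"
    unfolding p a using assms(5) by (intro finite_measure_mono) auto
  moreover have "0 \<le> p" "a \<le> 1" unfolding p a by simp_all
  ultimately have bounds: "0 \<le> p" "p \<le> a" "a \<le> 1" by simp_all
  have E: "?E n = (\<Sum>k<n. p * ?g k)" for n
    using expectation_leader_count[OF assms(2-5), of n] False assms(5)
    by (simp add: sublevel_betti_eq_sum p_def)
  have limit: "(\<lambda>n. ?E n / real n) \<longlonglongrightarrow> p * L" if "0 < p"
  proof -
    have "?g k = L + (1 - L) * (a - p) ^ k" for k
      using prob_clear[OF assms(2-5), of k] that bounds by (simp add: L_def flip: p_def a_def)
    then show ?thesis
      unfolding E using geometric_mean_tendsto[of "a - p" p L] that bounds by simp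
  qed
  have "(\<lambda>n. ?E n / real n) \<longlonglongrightarrow> 0" if "p = 0"
    unfolding E by (simp add: that)
  moreover have "(\<lambda>n. ?E n / real n) \<longlonglongrightarrow> 0" if "p = 1"
    using limit that bounds by (simp add: L_def)
  ultimately show ?thesis
    using limit by (auto simp: p_def[symmetric] a_def[symmetric] L_def mult.commute)
qed

end
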